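(* For every integer $k\ge 159$, the minimum Lee weight of every self-dual $\mathbb{Z}_4$-code of length $24k+8$ is at most $8k+4$.
   Context: A $\mathbb{Z}_4$-code of length $n$ is a $\mathbb{Z}_4$-submodule $\mathcal{C}$ of $\mathbb{Z}_4^n$, where $\mathbb{Z}_4=\{0,1,2,3\}$ is the ring of integers modulo $4$. Its dual is $\mathcal{C}^\perp=\{x\in\mathbb{Z}_4^n \mid x\cdot y=0 \text{ for all } y\in\mathcal{C}\}$, with $x\cdot y$ the standard inner product; $\mathcal{C}$ is self-dual if $\mathcal{C}=\mathcal{C}^\perp$. For $x\in\mathbb{Z}_4^n$ let $n_i(x)$ be the number of components of $x$ equal to $i$. The Lee weight of $x$ is $n_1(x)+2n_2(x)+n_3(x)$, and the minimum Lee weight of $\mathcal{C}$ is the smallest Lee weight among all non-zero codewords of $\mathcal{C}$. *)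

theory Defs
  imports "HOL-Analysis.Analysis"
begin

text \<open>
  The ring of integers modulo 4 is the numeral type \<^typ>\<open>4\<close>, and the elements of
  its \<open>n\<close>-th power are vectors of type \<^typ>\<open>4 ^ 'n\<close> with \<open>n = CARD('n)\<close>.
  The inner product class is specific to the reals; the standard bilinear form over a
  general semiring is \<^const>\<open>scalar_product\<close>.
\<close>

type_synonym Z4 = 4

definition Z4_code :: "(Z4 ^ 'n) set \<Rightarrow> bool" where
  "Z4_code C \<longleftrightarrow> module.subspace (*s) C"

definition dual_code :: "(Z4 ^ 'n) set \<Rightarrow> (Z4 ^ 'n) set" where
  "dual_code C = {x. \<forall>y\<in>C. scalar_product x y = 0}"

definition self_dual :: "(Z4 ^ 'n) set \<Rightarrow> bool" where
  "self_dual C \<longleftrightarrow> C = dual_code C"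

definition num_components :: "Z4 \<Rightarrow> Z4 ^ 'n \<Rightarrow> nat" where
  "num_components i x = card {j. x $ j = i}"

definition Lee_weight :: "Z4 ^ 'n \<Rightarrow> nat" where
  "Lee_weight x = num_components 1 x + 2 * num_components 2 x + num_components 3 x"

text \<open>Meaningful for codes with a non-zero codeword, in particular for self-dual codes
  (\<open>self_dual_nonzero_codeword\<close> below; the length is positive because types are non-empty).\<close>

definition min_Lee_weight :: "(Z4 ^ 'n) set \<Rightarrow> nat" where
  "min_Lee_weight C = Min (Lee_weight ` (C - {0}))"

lemma module_Z4_vec: "module ((*s) :: Z4 \<Rightarrow> Z4 ^ 'n \<Rightarrow> Z4 ^ 'n)"
  by unfold_locales (simp_all add: vector_add_ldistrib vector_sadd_rdistrib vector_smult_assoc)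

lemma self_dual_nonzero_codeword:
  fixes C :: "(Z4 ^ 'n) set"
  assumes "self_dual C"
  shows "C - {0} \<noteq> {}"
proof
  assume "C - {0} = {}"
  then have "dual_code C = UNIV"
    by (auto simp: dual_code_def scalar_product_def)
  with assms have "C = UNIV"
    by (simp add: self_dual_def)
  moreover have "(1 :: Z4 ^ 'n) \<noteq> 0"
    by simp
  ultimately show False
    using \<open>C - {0} = {}\<close> by blast
qed

end

theory Submission
  imports Defs "HOL-Computational_Algebra.Polynomial_FPS"
begin

text \<open>
  Let \<open>n = 24 k + 8\<close>. The supports of the odd entries of the codewords of \<open>C\<close> form a binary
  doubly even code. As \<open>8\<close> divides \<open>n\<close>, a maximal doubly even code \<open>D\<close> containing it is
  self-dual: the words of \<open>D\<^sup>\<bottom>\<close> outside \<open>D\<close> have weight \<open>2\<close> modulo \<open>4\<close>, and evaluating the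
  MacWilliams identity at \<open>\<i>\<close> leaves no room for them. Since \<open>2 D\<close> is contained in \<open>C\<close>, it
  suffices to find a non-zero word of weight at most \<open>4 k\<close> in \<open>D\<close>.

  Suppose that there is none, write \<open>g = \<Sum> a\<^sub>j z\<^sup>j\<close> with \<open>z = y\<^sup>4\<close> for the weight
  enumerator of \<open>D\<close>, and let \<open>\<phi> = 1 + 14 z + z\<^sup>2\<close>, \<open>\<epsilon> = 1 - 33 z - 33 z\<^sup>2 + z\<^sup>3\<close>.
  As in Gleason's theorem, \<open>g\<close> is a polynomial in \<open>\<phi>\<close> and \<open>z (1 - z)\<^sup>4\<close>, and the
  Lagrange inversion argument applied to \<open>u = \<phi>\<^sup>3 / (1 - z)\<^sup>4\<close>, for which
  \<open>u - z u' = \<phi>\<^sup>2 \<epsilon> / (1 - z)\<^sup>5\<close>, shows that the coefficient of \<open>z\<^sup>p\<close> in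
  \<open>g \<epsilon> \<phi>\<^sup>e / (1 - z)\<^bsup>4 p + 1\<^esup>\<close> vanishes when \<open>3 p = 3 k + 2 + e\<close>. A combination of
  the cases \<open>p = k + 2\<close> and \<open>p = k + 1\<close> eliminates \<open>a\<^bsub>k+1\<^esub>\<close> and expresses \<open>a\<^bsub>k+2\<^esub>\<close> as a
  function of \<open>k\<close> which is negative for \<open>k \<ge> 159\<close> (a theorem of Zhang).
\<close>

section \<open>Binary codes as families of sets\<close>

text \<open>A binary word is identified with its support, so that addition is symmetric difference
  and the inner product is the parity of the intersection.\<close>

definition binary_code :: "'a set set \<Rightarrow> bool" where
  "binary_code D \<longleftrightarrow> {} \<in> D \<and> (\<forall>A\<in>D. \<forall>B\<in>D. sym_diff A B \<in> D)"

definition binary_dual :: "'a set set \<Rightarrow> 'a set set" where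
  "binary_dual D = {B. \<forall>A\<in>D. even (card (A \<inter> B))}"

definition doubly_even :: "'a set set \<Rightarrow> bool" where
  "doubly_even D \<longleftrightarrow> (\<forall>A\<in>D. 4 dvd card A)"

lemma card_sym_diff:
  fixes A B :: "'a::finite set"
  shows "card (sym_diff A B) + 2 * card (A \<inter> B) = card A + card B"
proof -
  have "card (sym_diff A B) = card (A - B) + card (B - A)"
    by (rule card_Un_disjoint) auto
  moreover have "card A = card (A - B) + card (A \<inter> B)"
    by (metis Int_Diff_Un Int_Diff_disjoint add.commute card_Un_disjoint finite)
  moreover have "card B = card (B - A) + card (A \<inter> B)"
    by (metis Int_Diff_Un Int_Diff_disjoint Int_commute add.commute card_Un_disjoint finite)
  ultimately show ?thesis by simp
qed

lemma even_card_sym_diff_Int: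
  fixes A B X :: "'a::finite set"
  shows "even (card (sym_diff A B \<inter> X)) \<longleftrightarrow> (even (card (A \<inter> X)) \<longleftrightarrow> even (card (B \<inter> X)))"
proof -
  have "sym_diff A B \<inter> X = sym_diff (A \<inter> X) (B \<inter> X)" by auto
  then show ?thesis
    using card_sym_diff[of "A \<inter> X" "B \<inter> X"] by (metis even_add even_mult_iff even_numeral)
qed

section \<open>Character sums and the MacWilliams identity\<close>

lemma bij_betw_sym_diff:
  assumes "binary_code D" and "A \<in> D"
  shows "bij_betw (\<lambda>B. sym_diff B A) D D"
proof (rule bij_betw_byWitness[where f' = "\<lambda>B. sym_diff B A"])
  show "\<forall>B\<in>D. sym_diff (sym_diff B A) A = B" by auto
qed (use assms in \<open>auto simp: binary_code_def\<close>)

text \<open>Orthogonality of characters: translating by a word that meets \<open>B\<close> in an odd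
  set flips every sign, so outside the dual the sum equals its own negative.\<close>

lemma sum_sign_code:
  fixes D :: "'a::finite set set"
  assumes "binary_code D"
  shows "(\<Sum>A\<in>D. (- 1) ^ card (A \<inter> B) :: 'b::{idom,ring_char_0})
    = (if B \<in> binary_dual D then of_nat (card D) else 0)"
proof (cases "B \<in> binary_dual D")
  case True
  then show ?thesis by (simp add: binary_dual_def)
next
  case False
  then obtain A0 where A0: "A0 \<in> D" "odd (card (A0 \<inter> B))"
    by (auto simp: binary_dual_def)
  have "(\<Sum>A\<in>D. (- 1) ^ card (A \<inter> B) :: 'b) = (\<Sum>A\<in>D. (- 1) ^ card (sym_diff A A0 \<inter> B))"
    by (rule sum.reindex_bij_betw[OF bij_betw_sym_diff, symmetric]) (use assms A0 in auto)
  also have "\<dots> = (\<Sum>A\<in>D. - ((- 1) ^ card (A \<inter> B)))"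
    using A0(2) by (intro sum.cong) (auto simp: minus_one_power_iff even_card_sym_diff_Int)
  finally have "(\<Sum>A\<in>D. (- 1) ^ card (A \<inter> B) :: 'b) = - (\<Sum>A\<in>D. (- 1) ^ card (A \<inter> B))"
    by (simp add: sum_negf)
  then have "2 * (\<Sum>A\<in>D. (- 1) ^ card (A \<inter> B) :: 'b) = 0"
    by (simp only: mult_2 add_eq_0_iff)
  with False show ?thesis by simp
qed

text \<open>The right-hand side is a product over the coordinates; in its expansion \<open>B\<close>
  is the set of coordinates at which the term in \<open>t\<close> is chosen.\<close>

lemma sum_sign_Pow:
  fixes A :: "'a::finite set" and t :: "'b::comm_ring_1"
  shows "(\<Sum>B\<in>UNIV. (- 1) ^ card (A \<inter> B) * t ^ card B)
    = (1 + t) ^ (CARD('a) - card A) * (1 - t) ^ card A"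
proof -
  have "(1 + t) ^ (CARD('a) - card A) * (1 - t) ^ card A
    = (\<Prod>x\<in>-A. 1 + t) * (\<Prod>x\<in>A. 1 - t)"
    by (simp add: Compl_eq_Diff_UNIV card_Diff_subset)
  also have "\<dots> = (\<Prod>x\<in>-A. (if x \<in> A then - t else t) + 1) * (\<Prod>x\<in>A. (if x \<in> A then - t else t) + 1)"
    by (intro arg_cong2[where f = "(*)"] prod.cong) auto
  also have "\<dots> = (\<Prod>x\<in>UNIV. (if x \<in> A then - t else t) + 1)"
    by (subst prod.union_disjoint[symmetric]) auto
  also have "\<dots> = (\<Sum>B\<in>UNIV. \<Prod>x\<in>B. if x \<in> A then - t else t)"
    by (subst prod_add) auto
  also have "\<dots> = (\<Sum>B\<in>UNIV. (- 1) ^ card (A \<inter> B) * t ^ card B)"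
  proof (rule sum.cong)
    fix B :: "'a set"
    have "(\<Prod>x\<in>B. if x \<in> A then - t else t) = (\<Prod>x\<in>B. (if x \<in> A then - 1 else 1) * t)"
      by (intro prod.cong) auto
    also have "\<dots> = (\<Prod>x\<in>B. if x \<in> A then - 1 else 1) * t ^ card B"
      by (simp add: prod.distrib)
    also have "(\<Prod>x\<in>B. if x \<in> A then - 1 else 1 :: 'b) = (- 1) ^ card (A \<inter> B)"
      by (simp add: prod.If_cases Int_commute)
    finally show "(\<Prod>x\<in>B. if x \<in> A then - t else t) = (- 1) ^ card (A \<inter> B) * t ^ card B" .
  qed simp
  finally show ?thesis ..
qed

text \<open>The sum of \<open>sum_sign_Pow\<close> over all words of \<open>D\<close>, evaluated in
  the other order by \<open>sum_sign_code\<close>. The ring is kept general because \<open>t\<close>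
  will be an integer, a real number and \<open>\<i>\<close>.\<close>

theorem MacWilliams_identity:
  fixes D :: "'a::finite set set" and t :: "'b::{idom,ring_char_0}"
  assumes "binary_code D"
  shows "of_nat (card D) * (\<Sum>B\<in>binary_dual D. t ^ card B)
    = (\<Sum>A\<in>D. (1 + t) ^ (CARD('a) - card A) * (1 - t) ^ card A)"
proof -
  have "(\<Sum>A\<in>D. (1 + t) ^ (CARD('a) - card A) * (1 - t) ^ card A)
    = (\<Sum>A\<in>D. \<Sum>B\<in>UNIV. (- 1) ^ card (A \<inter> B) * t ^ card B)"
    by (simp add: sum_sign_Pow)
  also have "\<dots> = (\<Sum>B\<in>UNIV. (\<Sum>A\<in>D. (- 1) ^ card (A \<inter> B)) * t ^ card B)"
    by (subst sum.swap) (simp add: sum_distrib_right)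
  also have "\<dots> = (\<Sum>B\<in>UNIV. if B \<in> binary_dual D then of_nat (card D) * t ^ card B else 0)"
    using assms by (intro sum.cong) (auto simp: sum_sign_code)
  also have "\<dots> = of_nat (card D) * (\<Sum>B\<in>binary_dual D. t ^ card B)"
    by (simp add: sum.If_cases sum_distrib_left)
  finally show ?thesis ..
qed

text \<open>At \<open>t = 1\<close> only the empty word contributes to the transformed side.\<close>

lemma card_binary_dual:
  fixes D :: "'a::finite set set"
  assumes "binary_code D"
  shows "card D * card (binary_dual D) = 2 ^ CARD('a)"
proof -
  have "{} \<in> D" using assms by (simp add: binary_code_def)
  have "int (card D * card (binary_dual D))
    = (\<Sum>A\<in>D. 2 ^ (CARD('a) - card A) * 0 ^ card A)"
    using MacWilliams_identity[OF assms, of "1 :: int"] by simp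
  also have "\<dots> = (\<Sum>A\<in>D. if A = {} then 2 ^ CARD('a) else 0)"
    by (intro sum.cong) (auto simp: power_0_left)
  also have "\<dots> = int (2 ^ CARD('a))"
    using \<open>{} \<in> D\<close> by simp
  finally show ?thesis by (simp only: of_nat_eq_iff)
qed

section \<open>Doubly even codes and their self-dual extensions\<close>

lemma doubly_even_subset_binary_dual:
  fixes D :: "'a::finite set set"
  assumes "binary_code D" and "doubly_even D"
  shows "D \<subseteq> binary_dual D"
proof (clarsimp simp: binary_dual_def)
  fix A B assume "A \<in> D" "B \<in> D"
  then have "4 dvd card (sym_diff A B)" "4 dvd card A" "4 dvd card B"
    using assms by (auto simp: binary_code_def doubly_even_def)
  with card_sym_diff[of B A] show "even (card (B \<inter> A))"
    by (simp add: Un_commute) presburger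
qed

text \<open>Adjoining the coset of \<open>X\<close> keeps all weights divisible by 4, since
  \<open>card_sym_diff\<close> subtracts twice an even number.\<close>

lemma binary_code_extend:
  fixes D :: "'a::finite set set"
  assumes "binary_code D" and "doubly_even D" and "X \<in> binary_dual D" and "4 dvd card X"
  shows "binary_code (D \<union> sym_diff X ` D) \<and> doubly_even (D \<union> sym_diff X ` D)"
proof
  have closed: "sym_diff A B \<in> D" if "A \<in> D" "B \<in> D" for A B
    using assms(1) that by (simp add: binary_code_def)
  have mem: "E \<in> D \<union> sym_diff X ` D" if "E \<in> D \<or> sym_diff X E \<in> D" for E
    using that
  proof
    assume "sym_diff X E \<in> D"
    moreover have "E = sym_diff X (sym_diff X E)" by auto
    ultimately show ?thesis by (intro UnI2 image_eqI)
  qed simp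
  have mem': "E \<in> D \<or> sym_diff X E \<in> D" if E: "E \<in> D \<union> sym_diff X ` D" for E
    using E
  proof
    assume "E \<in> sym_diff X ` D"
    then obtain A where "A \<in> D" "E = sym_diff X A" by (elim imageE)
    moreover have "sym_diff X (sym_diff X A) = A" by auto
    ultimately show ?thesis by (simp only: simp_thms)
  qed simp
  show "binary_code (D \<union> sym_diff X ` D)"
    unfolding binary_code_def
  proof (intro conjI ballI)
    show "{} \<in> D \<union> sym_diff X ` D"
      using assms(1) by (intro mem) (simp add: binary_code_def)
    fix A B assume A: "A \<in> D \<union> sym_diff X ` D" and B: "B \<in> D \<union> sym_diff X ` D"
    note mem'[OF A] mem'[OF B]
    moreover have "sym_diff A (sym_diff X B) = sym_diff X (sym_diff A B)"
      "sym_diff (sym_diff X A) B = sym_diff X (sym_diff A B)"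
      "sym_diff (sym_diff X A) (sym_diff X B) = sym_diff A B"
      by auto
    ultimately have "sym_diff A B \<in> D \<or> sym_diff X (sym_diff A B) \<in> D"
      using closed[of A B] closed[of A "sym_diff X B"] closed[of "sym_diff X A" B]
        closed[of "sym_diff X A" "sym_diff X B"]
      by metis
    then show "sym_diff A B \<in> D \<union> sym_diff X ` D" by (rule mem)
  qed
  show "doubly_even (D \<union> sym_diff X ` D)"
    unfolding doubly_even_def
  proof
    fix B assume "B \<in> D \<union> sym_diff X ` D"
    then consider "B \<in> D" | A where "A \<in> D" "B = sym_diff X A" by blast
    then show "4 dvd card B"
    proof cases
      case 2
      have "even (card (X \<inter> A))" "4 dvd card A"
        using assms 2 by (auto simp: binary_dual_def doubly_even_def Int_commute)
      with assms(4) card_sym_diff[of X A] 2 show ?thesis by presburger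
    qed (use assms in \<open>simp add: doubly_even_def\<close>)
  qed
qed

lemma doubly_even_self_dual_extension:
  fixes R :: "'a::finite set set"
  assumes "binary_code R" and "doubly_even R" and "8 dvd CARD('a)"
  obtains D where "R \<subseteq> D" and "binary_code D" and "doubly_even D" and "binary_dual D = D"
proof -
  obtain N where N: "CARD('a) = 8 * N" using assms(3) by blast
  obtain D where D: "R \<subseteq> D" "binary_code D" "doubly_even D"
    and max: "\<And>E. binary_code E \<Longrightarrow> doubly_even E \<Longrightarrow> D \<subseteq> E \<Longrightarrow> D = E"
    using finite_has_maximal2[of "{E. binary_code E \<and> doubly_even E}" R] assms by auto
  have sub: "D \<subseteq> binary_dual D"
    using D by (intro doubly_even_subset_binary_dual)
  have ext: "X \<in> D" if "X \<in> binary_dual D" "4 dvd card X" for X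
  proof -
    have "D = D \<union> sym_diff X ` D"
      using binary_code_extend[OF D(2,3) that] by (intro max) auto
    moreover have "sym_diff X {} \<in> sym_diff X ` D"
      using D(2) unfolding binary_code_def by blast
    ultimately show ?thesis by auto
  qed
  have "UNIV \<in> binary_dual D"
    using D(3) by (auto simp: binary_dual_def doubly_even_def intro: dvd_trans[of 2 4])
  then have univ: "UNIV \<in> D" by (intro ext) (auto simp: N)
  \<comment> \<open>The all-ones word in \<open>D\<close> makes the weights in the dual even; by
    maximality those divisible by 4 occur exactly in \<open>D\<close>.\<close>
  have weight: "\<i> ^ card X = (if X \<in> D then 1 else - 1)" if "X \<in> binary_dual D" for X
  proof -
    have "even (card X)"
      using that univ by (auto simp: binary_dual_def dest: bspec[of _ _ UNIV])
    moreover have "4 dvd card X \<longleftrightarrow> X \<in> D"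
      using ext[OF that] D(3) by (auto simp: doubly_even_def)
    ultimately show ?thesis
      by (auto elim!: evenE simp: power_mult minus_one_power_iff)
  qed
  let ?a = "card D" and ?b = "card (binary_dual D)"
  have pow4: "(1 + \<i>) ^ 8 = 16" "(1 + \<i>) ^ 4 = - 4" "(1 - \<i>) ^ 4 = - 4"
    by (simp_all add: eval_nat_numeral algebra_simps)
  have "of_nat ?a * (\<Sum>B\<in>binary_dual D. \<i> ^ card B)
    = (\<Sum>A\<in>D. (1 + \<i>) ^ (CARD('a) - card A) * (1 - \<i>) ^ card A)"
    by (rule MacWilliams_identity[OF D(2)])
  \<comment> \<open>Weights in \<open>D\<close> are multiples of 4, so each summand is a product of
    \<open>2 * N\<close> factors \<open>- 4\<close>.\<close>
  also have "\<dots> = (\<Sum>A\<in>D. 16 ^ N)"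
  proof (rule sum.cong)
    fix A assume "A \<in> D"
    then obtain r where r: "card A = 4 * r" using D(3) by (auto simp: doubly_even_def)
    have "card A \<le> CARD('a)" by (simp add: card_mono)
    then have "r \<le> 2 * N" "CARD('a) - card A = 4 * (2 * N - r)" using r N by auto
    then have "(1 + \<i>) ^ (CARD('a) - card A) * (1 - \<i>) ^ card A = (- 4) ^ (2 * N - r) * (- 4) ^ r"
      using r by (simp only: power_mult pow4)
    also have "\<dots> = (- 4) ^ (2 * N)"
      using \<open>r \<le> 2 * N\<close> by (simp only: power_add[symmetric]) simp
    finally show "(1 + \<i>) ^ (CARD('a) - card A) * (1 - \<i>) ^ card A = 16 ^ N"
      by (simp add: power_mult)
  qed simp
  also have "\<dots> = of_nat ?a * 16 ^ N" by simp
  finally have "of_nat ?a * (\<Sum>B\<in>binary_dual D. \<i> ^ card B) = of_nat ?a * 16 ^ N" .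
  moreover have "?a > 0"
    using D(2) by (auto simp: binary_code_def card_gt_0_iff)
  ultimately have "(\<Sum>B\<in>binary_dual D. \<i> ^ card B) = 16 ^ N" by auto
  moreover have "(\<Sum>B\<in>binary_dual D. \<i> ^ card B) = of_int (2 * int ?a - int ?b)"
  proof -
    have "(\<Sum>B\<in>binary_dual D. \<i> ^ card B) = (\<Sum>B\<in>binary_dual D. if B \<in> D then 1 else - 1)"
      using weight by (intro sum.cong) auto
    also have "\<dots> = of_nat ?a - of_nat (card (binary_dual D - D))"
      using sub by (simp add: sum.If_cases Int_absorb1 Diff_eq)
    finally show ?thesis
      using sub card_mono[OF _ sub] by (simp add: card_Diff_subset of_nat_diff)
  qed
  ultimately have "(of_int (2 * int ?a - int ?b) :: complex) = of_int (16 ^ N)" by simp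
  then have diff: "2 * int ?a - int ?b = 16 ^ N" by (simp only: of_int_eq_iff)
  have prod: "int ?a * int ?b = 16 ^ N * 16 ^ N"
  proof -
    have "?a * ?b = 16 ^ N * 16 ^ N"
      using card_binary_dual[OF D(2)] by (simp add: N power_mult flip: power_mult_distrib)
    then show ?thesis by (metis of_nat_mult of_nat_numeral of_nat_power)
  qed
  have "?a \<le> ?b" using sub by (simp add: card_mono)
  moreover have "?a \<ge> ?b"
  proof (rule ccontr)
    assume "\<not> ?a \<ge> ?b"
    \<comment> \<open>With \<open>a\<close> for the size of \<open>D\<close>, the equations
      \<open>diff\<close> and \<open>prod\<close> become \<open>a - s = 16 ^ N\<close> and
      \<open>a (a + s) = (a - s)^2\<close>. A positive \<open>s\<close> must then be
      \<open>3 a\<close>, which makes \<open>16 ^ N\<close> negative.\<close>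
    define s where "s = int ?b - int ?a"
    have "s > 0" using \<open>\<not> ?a \<ge> ?b\<close> by (simp add: s_def)
    have "int ?a * (int ?a + s) = (int ?a - s) * (int ?a - s)"
      using prod diff by (simp add: s_def algebra_simps flip: diff)
    then have "s * (3 * int ?a - s) = 0" by algebra
    with \<open>s > 0\<close> have "s = 3 * int ?a" by simp
    with diff have "16 ^ N = - 2 * int ?a" by (simp add: s_def)
    moreover have "(16::int) ^ N > 0" by simp
    ultimately show False by linarith
  qed
  ultimately have "binary_dual D = D"
    using card_subset_eq[OF _ sub] by simp
  with D that show ?thesis by blast
qed

section \<open>Type II weight enumerators\<close>

text \<open>The invariants of the octahedron with vertices \<open>0\<close>, \<open>\<infinity>\<close> and the solutions of \<open>y\<^sup>4 = 1\<close>,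
  dehomogenised and written in \<open>z = y\<^sup>4\<close>; the vertex form enters through its fourth power.\<close>

definition octa_face :: "real poly" where "octa_face = [:1, 14, 1:]"
definition octa_edge :: "real poly" where "octa_edge = [:1, - 33, - 33, 1:]"
definition octa_vertex :: "real poly" where "octa_vertex = [:0, 1:] * [:1, - 1:] ^ 4"

text \<open>A polynomial in \<open>z = y\<^sup>4\<close> satisfying the MacWilliams identity in length \<open>8 m\<close> and
  the symmetry of codes containing the all-ones word. Both are demanded only on the unit interval,
  where no denominator vanishes; this already determines polynomials.\<close>

definition type_II :: "nat \<Rightarrow> real poly \<Rightarrow> bool" where
  "type_II m g \<longleftrightarrow> degree g \<le> 2 * m
    \<and> (\<forall>y. 0 < y \<and> y < 1 \<longrightarrow>
        16 ^ m * poly g (y ^ 4) = (1 + y) ^ (8 * m) * poly g (((1 - y) / (1 + y)) ^ 4))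
    \<and> (\<forall>z. 0 < z \<and> z < 1 \<longrightarrow> poly g z = z ^ (2 * m) * poly g (1 / z))"

lemma type_IID:
  assumes "type_II m g"
  shows "degree g \<le> 2 * m"
    and "\<lbrakk>0 < y; y < 1\<rbrakk> \<Longrightarrow>
      16 ^ m * poly g (y ^ 4) = (1 + y) ^ (8 * m) * poly g (((1 - y) / (1 + y)) ^ 4)"
    and "\<lbrakk>0 < z; z < 1\<rbrakk> \<Longrightarrow> poly g z = z ^ (2 * m) * poly g (1 / z)"
  using assms unfolding type_II_def by blast+

text \<open>\<open>octa_face\<close> is the weight enumerator of the extended Hamming code of length
  8, the case \<open>m = 1\<close>; both identities are multiplicative.\<close>

lemma type_II_octa_face: "type_II m (octa_face ^ m)"
  unfolding type_II_def
proof (intro conjI allI impI)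
  show "degree (octa_face ^ m) \<le> 2 * m"
    by (simp add: degree_power_eq octa_face_def)
next
  fix y :: real assume y: "0 < y \<and> y < 1"
  then have "16 * poly octa_face (y ^ 4) = (1 + y) ^ 8 * poly octa_face (((1 - y) / (1 + y)) ^ 4)"
    by (simp add: octa_face_def power_divide divide_simps) algebra
  then have "(16 * poly octa_face (y ^ 4)) ^ m = ((1 + y) ^ 8 * poly octa_face (((1 - y) / (1 + y)) ^ 4)) ^ m"
    by simp
  then show "16 ^ m * poly (octa_face ^ m) (y ^ 4)
    = (1 + y) ^ (8 * m) * poly (octa_face ^ m) (((1 - y) / (1 + y)) ^ 4)"
    by (simp only: power_mult_distrib poly_power power_mult)
next
  fix z :: real assume z: "0 < z \<and> z < 1"
  then have "poly octa_face z = z ^ 2 * poly octa_face (1 / z)"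
    by (simp add: octa_face_def field_simps power2_eq_square)
  then have "poly octa_face z ^ m = (z ^ 2 * poly octa_face (1 / z)) ^ m"
    by simp
  then show "poly (octa_face ^ m) z = z ^ (2 * m) * poly (octa_face ^ m) (1 / z)"
    by (simp only: power_mult_distrib poly_power power_mult)
qed

lemma type_II_diff_smult:
  assumes "type_II m g" and "type_II m h"
  shows "type_II m (g - smult a h)"
proof -
  have deg: "degree (g - smult a h) \<le> 2 * m"
    using assms by (intro degree_diff_le order_trans[OF degree_smult_le]) (auto dest: type_IID(1))
  have "c * poly (g - smult a h) x = d * poly (g - smult a h) w"
    if "c * poly g x = d * poly g w" "c * poly h x = d * poly h w" for c d x w
  proof -
    have "c * poly (g - smult a h) x = c * poly g x - a * (c * poly h x)" by (simp add: algebra_simps)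
    also have "\<dots> = d * poly (g - smult a h) w" unfolding that by (simp add: algebra_simps)
    finally show ?thesis .
  qed
  note lin = this
  have "16 ^ m * poly (g - smult a h) (y ^ 4)
      = (1 + y) ^ (8 * m) * poly (g - smult a h) (((1 - y) / (1 + y)) ^ 4)" if "0 < y" "y < 1" for y
    by (intro lin type_IID(2) assms that)
  moreover have "1 * poly (g - smult a h) z = z ^ (2 * m) * poly (g - smult a h) (1 / z)"
    if "0 < z" "z < 1" for z
    by (intro lin; unfold mult_1) (intro type_IID(3) assms that)+
  ultimately show ?thesis using deg unfolding type_II_def mult_1 by blast
qed

lemma poly_eqI_unit_interval:
  fixes p q :: "real poly"
  assumes "\<And>z. 0 < z \<Longrightarrow> z < 1 \<Longrightarrow> poly p z = poly q z"
  shows "p = q"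
proof (rule ccontr)
  assume "p \<noteq> q"
  then have "finite {z. poly (p - q) z = 0}"
    by (intro poly_roots_finite) simp
  moreover have "{0<..<1} \<subseteq> {z. poly (p - q) z = 0}"
    using assms by auto
  ultimately show False
    using infinite_super infinite_Ioo[of "0::real" 1] zero_less_one by blast
qed

text \<open>The reciprocal identity makes the coefficients up to degree \<open>2 * m\<close>
  palindromic, so the top one vanishes with the constant one.\<close>

lemma type_II_degree_less:
  assumes "type_II m g" and "coeff g 0 = 0" and "g \<noteq> 0"
  shows "degree g < 2 * m"
proof -
  have deg: "degree g \<le> 2 * m" by (rule type_IID(1)[OF assms(1)])
  define h where "h = (\<Sum>i\<le>2 * m. monom (coeff g i) (2 * m - i))"
  have "g = h"
  proof (rule poly_eqI_unit_interval)
    fix z :: real assume z: "0 < z" "z < 1"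
    then have "poly g z = z ^ (2 * m) * poly (\<Sum>i\<le>2 * m. monom (coeff g i) i) (1 / z)"
      unfolding poly_as_sum_of_monoms'[OF deg] by (intro type_IID(3)[OF assms(1)])
    also have "\<dots> = (\<Sum>i\<le>2 * m. coeff g i * (z ^ (2 * m) / z ^ i))"
      by (simp add: poly_sum poly_monom sum_distrib_left power_divide ac_simps)
    also have "\<dots> = (\<Sum>i\<le>2 * m. coeff g i * z ^ (2 * m - i))"
      using z by (intro sum.cong) (auto simp: power_diff)
    finally show "poly g z = poly h z"
      by (simp add: h_def poly_sum poly_monom)
  qed
  have "coeff h (2 * m) = (\<Sum>i\<le>2 * m. if i = 0 then coeff g 0 else 0)"
    unfolding h_def coeff_sum by (intro sum.cong) (auto split: if_splits)
  with assms(2) \<open>g = h\<close> have "coeff g (2 * m) = 0" by simp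
  with assms(3) deg show ?thesis
    by (metis leading_coeff_0_iff nless_le)
qed

text \<open>Letting \<open>z\<close> tend to 1 gives a zero there; dividing it out leaves a quotient
  that satisfies the bound with the exponent lowered by one.\<close>

lemma power_dvd_of_bound:
  fixes g :: "real poly"
  assumes "\<And>z. 0 < z \<Longrightarrow> z < 1 \<Longrightarrow> \<bar>poly g z\<bar> \<le> K * (1 - z) ^ n"
  shows "[:1, - 1:] ^ n dvd g"
  using assms
proof (induction n arbitrary: g)
  case (Suc n)
  have "((\<lambda>z. K * (1 - z) ^ Suc n) \<longlongrightarrow> K * (1 - 1) ^ Suc n) (at_left 1)"
    by (intro tendsto_intros)
  then have lim0: "((\<lambda>z. K * (1 - z) ^ Suc n) \<longlongrightarrow> 0) (at_left 1)" by simp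
  have "eventually (\<lambda>z. z \<in> {0<..<1}) (at_left (1::real))"
    by (rule eventually_at_leftI[of 0]) auto
  then have "eventually (\<lambda>z. norm (poly g z) \<le> K * (1 - z) ^ Suc n) (at_left 1)"
    by (rule eventually_mono) (use Suc.prems in auto)
  then have "(poly g \<longlongrightarrow> 0) (at_left 1)"
    by (rule Lim_null_comparison[OF _ lim0])
  moreover have "(poly g \<longlongrightarrow> poly g 1) (at_left 1)"
    by (intro tendsto_intros)
  ultimately have "poly g 1 = 0"
    using tendsto_unique[of "at_left (1::real)"] by (metis trivial_limit_at_left_real)
  then obtain r where r: "g = [:- 1, 1:] * r"
    by (auto simp: poly_eq_0_iff_dvd elim!: dvdE)
  have "[:1, - 1:] ^ n dvd - r"
  proof (rule Suc.IH)
    fix z :: real assume z: "0 < z" "z < 1"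
    have "(1 - z) * \<bar>poly (- r) z\<bar> = \<bar>poly g z\<bar>"
    proof -
      have "poly g z = (1 - z) * poly (- r) z" by (simp add: r algebra_simps)
      then show ?thesis using z by (simp only: abs_mult)
    qed
    also have "\<dots> \<le> (1 - z) * (K * (1 - z) ^ n)"
      using Suc.prems[OF z] by (simp add: mult_ac)
    finally show "\<bar>poly (- r) z\<bar> \<le> K * (1 - z) ^ n"
      using z by simp
  qed
  moreover have "g = [:1, - 1:] * (- r)" by (simp add: r)
  ultimately show ?case
    by (metis dvd_mult_left mult_dvd_mono dvd_refl power_Suc)
qed simp

lemma X_dvd_of_coeff_0:
  fixes g :: "'a::comm_semiring_1 poly"
  assumes "coeff g 0 = 0"
  shows "[:0, 1:] dvd g"
  using assms by (cases g) (auto intro!: dvdI)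

lemma poly_octa_vertex: "poly octa_vertex z = z * (1 - z) ^ 4"
  by (simp add: octa_vertex_def)

text \<open>With \<open>octa_vertex_reciprocal\<close>, this gives \<open>octa_vertex\<close> both
  identities of \<open>type_II\<close> for \<open>m = 3\<close>; cancelling it from them lowers
  \<open>m\<close> by 3.\<close>

lemma octa_vertex_MacWilliams:
  assumes "0 < y" "y < 1"
  shows "16 ^ 3 * poly octa_vertex (y ^ 4) = (1 + y) ^ 24 * poly octa_vertex (((1 - y) / (1 + y)) ^ 4)"
proof -
  define s where "s = (1 - y) / (1 + y)"
  have s: "(1 + y) * s = 1 - y" using assms by (simp add: s_def)
  have "(1 + y) ^ 24 * poly octa_vertex (s ^ 4)
    = (1 + y) ^ 4 * ((1 + y) * s) ^ 4 * ((1 + y) ^ 4 - ((1 + y) * s) ^ 4) ^ 4"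
  proof -
    have "a ^ 24 * (s ^ 4 * (1 - s ^ 4) ^ 4) = a ^ 4 * (a * s) ^ 4 * (a ^ 4 - (a * s) ^ 4) ^ 4" for a
    proof -
      have "a ^ 4 - (a * s) ^ 4 = a ^ 4 * (1 - s ^ 4)"
        by (simp add: power_mult_distrib right_diff_distrib)
      moreover have "a ^ 24 = a ^ 4 * a ^ 4 * (a ^ 4) ^ 4"
        by (simp flip: power_mult power_add)
      ultimately show ?thesis
        by (simp only: power_mult_distrib mult_ac)
    qed
    then show ?thesis by (simp only: poly_octa_vertex)
  qed
  also have "\<dots> = (1 + y) ^ 4 * (1 - y) ^ 4 * (8 * y * (1 + y\<^sup>2)) ^ 4"
  proof -
    have "(1 + y) ^ 4 - (1 - y) ^ 4 = 8 * y * (1 + y\<^sup>2)" by algebra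
    then show ?thesis by (simp only: s)
  qed
  also have "\<dots> = 16 ^ 3 * (y ^ 4 * ((1 + y) * (1 - y) * (1 + y\<^sup>2)) ^ 4)"
    by (simp add: power_mult_distrib)
  also have "(1 + y) * (1 - y) * (1 + y\<^sup>2) = 1 - y ^ 4" by algebra
  finally show ?thesis by (simp add: poly_octa_vertex s_def)
qed

lemma octa_vertex_reciprocal:
  assumes "0 < z" "z < 1"
  shows "poly octa_vertex z = z ^ 6 * poly octa_vertex (1 / z)"
proof -
  have "z ^ 6 * poly octa_vertex (1 / z) = z * (z * (1 - 1 / z)) ^ 4"
    using assms by (simp add: poly_octa_vertex power_mult_distrib eval_nat_numeral)
  also have "z * (1 - 1 / z) = z - 1"
    using assms by (simp add: algebra_simps)
  finally show ?thesis
    by (simp add: poly_octa_vertex power4_eq_xxxx algebra_simps)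
qed

text \<open>The MacWilliams transform carries the zero at the vertex \<open>0\<close> to the other vertices.\<close>

lemma type_II_cusp:
  assumes "type_II m g" and "coeff g 0 = 0"
  shows "\<exists>q. g = octa_vertex * q \<and> (if m < 3 then q = 0 else type_II (m - 3) q)"
proof (cases "g = 0")
  case True
  then show ?thesis by (intro exI[of _ 0]) (simp add: type_II_def)
next
  case False
  obtain r where r: "g = [:0, 1:] * r"
    using X_dvd_of_coeff_0[OF assms(2)] by (elim dvdE)
  have "bounded (poly r ` {0..1})"
    by (intro compact_imp_bounded compact_continuous_image continuous_intros) auto
  then obtain K where "K > 0" and K: "\<And>z. z \<in> {0..1} \<Longrightarrow> \<bar>poly r z\<bar> \<le> K"
    unfolding bounded_pos by auto
  \<comment> \<open>For \<open>z = y ^ 4\<close>, the transform expresses \<open>g\<close> at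
    \<open>z\<close> through its value at \<open>s ^ 4\<close>, which is of order
    \<open>s ^ 4\<close> because \<open>g\<close> vanishes at 0. Here
    \<open>s \<le> 1 - y \<le> 1 - z\<close>.\<close>
  have "[:1, - 1:] ^ 4 dvd g"
  proof (rule power_dvd_of_bound)
    fix z :: real assume z: "0 < z" "z < 1"
    define y where "y = root 4 z"
    define s where "s = (1 - y) / (1 + y)"
    have y: "0 < y" "y < 1" "y ^ 4 = z"
      using z by (simp_all add: y_def)
    have s: "0 < s" "s < 1" "s \<le> 1 - y"
      using y by (simp_all add: s_def field_simps)
    have "16 ^ m * poly g (y ^ 4) = (1 + y) ^ (8 * m) * poly g (s ^ 4)"
      unfolding s_def using y(1,2) by (rule type_IID(2)[OF assms(1)])
    also have "poly g (s ^ 4) = s ^ 4 * poly r (s ^ 4)"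
      by (simp add: r)
    finally have g: "16 ^ m * poly g z = (1 + y) ^ (8 * m) * (s ^ 4 * poly r (s ^ 4))"
      by (simp only: y(3))
    have "\<bar>poly g z\<bar> \<le> 16 ^ m * \<bar>poly g z\<bar>"
      using mult_right_mono[of 1 "16 ^ m" "\<bar>poly g z\<bar>"] by simp
    also have "\<dots> = \<bar>16 ^ m * poly g z\<bar>"
      by (simp add: abs_mult)
    also have "\<dots> = (1 + y) ^ (8 * m) * (s ^ 4 * \<bar>poly r (s ^ 4)\<bar>)"
      unfolding g using y(1) s(1) by (simp add: abs_mult)
    also have "\<dots> \<le> 2 ^ (8 * m) * ((1 - z) ^ 4 * K)"
    proof (intro mult_mono power_mono)
      have "y ^ 4 \<le> y" using y power_decreasing[of 1 4 y] by simp
      with y s show "s \<le> 1 - z" by simp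
      show "\<bar>poly r (s ^ 4)\<bar> \<le> K" using s by (intro K) (auto intro: power_le_one)
    qed (use y s \<open>K > 0\<close> z in auto)
    finally show "\<bar>poly g z\<bar> \<le> (2 ^ (8 * m) * K) * (1 - z) ^ 4"
      by (simp add: mult_ac)
  qed
  then obtain v where v: "g = [:1, - 1:] ^ 4 * v" by (elim dvdE)
  have "coeff v 0 = 0"
    using assms(2) by (simp add: v coeff_mult_0 coeff_0_power)
  from X_dvd_of_coeff_0[OF this] obtain q where q: "v = [:0, 1:] * q"
    by (elim dvdE)
  have gq: "g = octa_vertex * q" by (simp add: v q octa_vertex_def mult_ac)
  have nz: "q \<noteq> 0" "octa_vertex \<noteq> 0"
    using False unfolding gq by auto
  have "degree octa_vertex = degree [:0, 1 :: real:] + degree ([:1, - 1 :: real:] ^ 4)"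
    unfolding octa_vertex_def by (rule degree_mult_eq) simp_all
  then have "degree octa_vertex = 5"
    by (simp add: degree_power_eq)
  then have "degree g = 5 + degree q"
    unfolding gq by (simp only: degree_mult_eq[OF nz(2,1)])
  \<comment> \<open>Strictness matters: it forces \<open>m \<ge> 3\<close> and yields degree at most
    \<open>2 * (m - 3)\<close> for \<open>q\<close>, rather than \<open>2 * m - 5\<close>.\<close>
  with type_II_degree_less[OF assms False] have deg: "5 + degree q < 2 * m" by simp
  define l where "l = m - 3"
  have l: "m = l + 3" using deg by (simp add: l_def)
  have "type_II l q"
    unfolding type_II_def
  proof (intro conjI allI impI)
    show "degree q \<le> 2 * l" using deg l by simp
  next
    fix y :: real assume y: "0 < y \<and> y < 1"
    let ?s = "((1 - y) / (1 + y)) ^ 4"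
    have "(16 ^ 3 * poly octa_vertex (y ^ 4)) * (16 ^ l * poly q (y ^ 4))
      = 16 ^ m * poly g (y ^ 4)"
      by (simp add: gq l power_add)
    also have "\<dots> = (1 + y) ^ (8 * m) * poly g ?s"
      using y by (intro type_IID(2)[OF assms(1)]) auto
    also have "\<dots> = ((1 + y) ^ 24 * poly octa_vertex ?s) * ((1 + y) ^ (8 * l) * poly q ?s)"
      by (simp add: gq l power_add)
    also have "(1 + y) ^ 24 * poly octa_vertex ?s = 16 ^ 3 * poly octa_vertex (y ^ 4)"
      using octa_vertex_MacWilliams y by simp
    finally have "poly octa_vertex (y ^ 4) * (16 ^ l * poly q (y ^ 4))
      = poly octa_vertex (y ^ 4) * ((1 + y) ^ (8 * l) * poly q ?s)"
      by simp
    moreover have "y ^ 4 < 1" using y by (simp add: power_less_one_iff)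
    then have "poly octa_vertex (y ^ 4) \<noteq> 0" using y by (simp add: poly_octa_vertex)
    ultimately show "16 ^ l * poly q (y ^ 4) = (1 + y) ^ (8 * l) * poly q ?s" by simp
  next
    fix z :: real assume z: "0 < z \<and> z < 1"
    have "poly octa_vertex z * poly q z = poly g z" by (simp add: gq)
    also have "\<dots> = z ^ (2 * m) * poly g (1 / z)"
      using z by (intro type_IID(3)[OF assms(1)]) auto
    also have "\<dots> = (z ^ 6 * poly octa_vertex (1 / z)) * (z ^ (2 * l) * poly q (1 / z))"
      by (simp add: gq l power_add)
    also have "z ^ 6 * poly octa_vertex (1 / z) = poly octa_vertex z"
      using octa_vertex_reciprocal z by simp
    finally show "poly q z = z ^ (2 * l) * poly q (1 / z)"
      using z by (simp add: poly_octa_vertex)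
  qed
  with gq l show ?thesis by auto
qed

section \<open>A linear relation between the coefficients\<close>

definition geom_fps :: "real fps" where "geom_fps = inverse (1 - fps_X)"

lemma geom_fps_mult: "geom_fps * (1 - fps_X) = 1"
  unfolding geom_fps_def by (rule inverse_mult_eq_1) simp

lemma deriv_geom_fps: "fps_deriv geom_fps = geom_fps ^ 2"
  unfolding geom_fps_def by (simp add: fps_inverse_deriv)

text \<open>The product of \<open>u ^ n\<close> and the derivative of \<open>u\<close> is the
  derivative of \<open>u ^ Suc n\<close> divided by \<open>Suc n\<close>, and differentiating and
  multiplying by \<open>fps_X\<close> scales coefficient \<open>Suc n\<close> by
  \<open>Suc n\<close>.\<close>

lemma Lagrange_residue:
  fixes u :: "real fps"
  shows "fps_nth (u ^ n * (u - fps_X * fps_deriv u)) (Suc n) = 0"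
proof -
  have deriv: "fps_deriv (u ^ Suc n) = fps_const (of_nat (Suc n)) * (u ^ n * fps_deriv u)"
    by (simp only: fps_deriv_power diff_Suc_1 mult_ac)
  have "of_nat (Suc n) * fps_nth (fps_X * (u ^ n * fps_deriv u)) (Suc n)
    = fps_nth (fps_deriv (u ^ Suc n)) n"
    unfolding deriv by (simp only: fps_mult_left_const_nth fps_X_mult_nth) simp
  also have "\<dots> = of_nat (Suc n) * fps_nth (u ^ Suc n) (Suc n)"
    by (simp only: fps_deriv_nth Suc_eq_plus1)
  finally have "fps_nth (fps_X * (u ^ n * fps_deriv u)) (Suc n) = fps_nth (u ^ Suc n) (Suc n)"
    by (simp only: mult_cancel_left) simp
  then show ?thesis
    by (simp add: algebra_simps)
qed

text \<open>The residue relation for \<open>g = \<phi> ^ m\<close> with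
  \<open>m + e = 3 * n + 2\<close>: the series is \<open>u ^ n\<close> times
  \<open>u - z u'\<close>.\<close>

lemma octa_residue_face:
  "fps_nth (fps_of_poly (octa_edge * octa_face ^ (3 * n + 2)) * geom_fps ^ (4 * n + 5)) (Suc n) = 0"
proof -
  define F where "F = fps_of_poly octa_face"
  define u where "u = F ^ 3 * geom_fps ^ 4"
  have F: "F = 1 + 14 * fps_X + fps_X ^ 2"
    by (simp add: F_def octa_face_def fps_of_poly_pCons power2_eq_square algebra_simps numeral_fps_const)
  have f: "fps_of_poly octa_edge = 1 - 33 * fps_X - 33 * fps_X ^ 2 + fps_X ^ 3"
    by (simp add: octa_edge_def fps_of_poly_pCons power2_eq_square power3_eq_cube algebra_simps
        numeral_fps_const)
  have dF: "fps_deriv F = 14 + 2 * fps_X"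
    by (simp add: F fps_deriv_power)
  have "fps_deriv u = 3 * F ^ 2 * fps_deriv F * geom_fps ^ 4 + F ^ 3 * (4 * geom_fps ^ 5)"
    by (simp add: u_def fps_deriv_power deriv_geom_fps eval_nat_numeral algebra_simps)
  then have "u - fps_X * fps_deriv u
    = F ^ 3 * geom_fps ^ 4 - fps_X * (3 * F ^ 2 * (14 + 2 * fps_X) * geom_fps ^ 4 + F ^ 3 * (4 * geom_fps ^ 5))"
    by (simp only: u_def dF)
  \<comment> \<open>After removing \<phi>^2 and clearing the denominators, this reads \<phi> (1 - z)
    - z (3 \<phi>' (1 - z) + 4 \<phi>) = \<epsilon>.\<close>
  also have "\<dots> = F\<^sup>2 * geom_fps ^ 5 * fps_of_poly octa_edge"
    using geom_fps_mult unfolding F f by algebra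
  finally have "u - fps_X * fps_deriv u = F\<^sup>2 * geom_fps ^ 5 * fps_of_poly octa_edge" .
  then have "fps_of_poly (octa_edge * octa_face ^ (3 * n + 2)) * geom_fps ^ (4 * n + 5)
    = u ^ n * (u - fps_X * fps_deriv u)"
    by (simp only: u_def fps_of_poly_mult fps_of_poly_power power_mult_distrib power_add
        mult_ac flip: power_mult F_def)
  then show ?thesis by (simp only: Lagrange_residue)
qed

text \<open>Subtracting a multiple of \<phi>^m, settled by \<open>octa_residue_face\<close>, leaves
  \<open>octa_vertex\<close> times an enumerator for \<open>m - 3\<close>. The factor z (1 - z)^4
  lowers \<open>n\<close> by one and the power of \<open>geom_fps\<close> by four, while
  \<open>e\<close> stays fixed.\<close>

theorem octa_residue:
  assumes "type_II m g" and "3 * Suc n = m + 1 + e"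
  shows "fps_nth (fps_of_poly (g * octa_edge * octa_face ^ e) * geom_fps ^ (4 * n + 5)) (Suc n) = 0"
  using assms
proof (induction m arbitrary: g n rule: less_induct)
  case (less m)
  define a where "a = coeff g 0"
  have "coeff octa_face 0 = 1" by (simp add: octa_face_def)
  then have "coeff (g - smult a (octa_face ^ m)) 0 = 0"
    by (simp add: a_def coeff_0_power)
  from type_II_cusp[OF type_II_diff_smult[OF less.prems(1) type_II_octa_face] this]
  obtain q where q: "g - smult a (octa_face ^ m) = octa_vertex * q"
    "if m < 3 then q = 0 else type_II (m - 3) q" by blast
  then have "g = smult a (octa_face ^ m) + octa_vertex * q"
    by (simp add: diff_eq_eq add.commute)
  moreover have "m + e = 3 * n + 2" using less.prems(2) by simp
  ultimately have "g * octa_edge * octa_face ^ e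
    = smult a (octa_edge * octa_face ^ (3 * n + 2)) + octa_vertex * (q * octa_edge * octa_face ^ e)"
    by (simp add: algebra_simps flip: power_add)
  then have split: "fps_nth (fps_of_poly (g * octa_edge * octa_face ^ e) * geom_fps ^ (4 * n + 5)) (Suc n)
    = a * fps_nth (fps_of_poly (octa_edge * octa_face ^ (3 * n + 2)) * geom_fps ^ (4 * n + 5)) (Suc n)
      + fps_nth (fps_of_poly octa_vertex * fps_of_poly (q * octa_edge * octa_face ^ e)
          * geom_fps ^ (4 * n + 5)) (Suc n)"
    by (simp only: fps_of_poly_add fps_of_poly_mult fps_of_poly_smult distrib_right fps_add_nth
        mult.assoc fps_mult_left_const_nth)
  have "fps_nth (fps_of_poly octa_vertex * fps_of_poly (q * octa_edge * octa_face ^ e)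
          * geom_fps ^ (4 * n + 5)) (Suc n) = 0"
  proof (cases "m < 3")
    case True
    then show ?thesis using q(2) by simp
  next
    case False
    \<comment> \<open>For \<open>m \<ge> 3\<close> the relation between \<open>m\<close>,
      \<open>n\<close> and \<open>e\<close> excludes \<open>n = 0\<close>.\<close>
    with less.prems(2) obtain n' where n: "n = Suc n'" by (cases n) auto
    have "fps_nth (fps_of_poly octa_vertex * fps_of_poly (q * octa_edge * octa_face ^ e)
          * geom_fps ^ (4 * n + 5)) (Suc n)
      = fps_nth (fps_of_poly (q * octa_edge * octa_face ^ e) * (geom_fps ^ 4 * fps_of_poly [:1, -1:] ^ 4)
          * geom_fps ^ (4 * n' + 5)) (Suc n')"
    proof -
      have "fps_of_poly octa_vertex * fps_of_poly (q * octa_edge * octa_face ^ e) * geom_fps ^ (4 * n + 5)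
        = fps_X * (fps_of_poly (q * octa_edge * octa_face ^ e) * (geom_fps ^ 4 * fps_of_poly [:1, -1:] ^ 4)
          * geom_fps ^ (4 * n' + 5))"
      proof -
        have "fps_of_poly octa_vertex = fps_X * fps_of_poly [:1, -1:] ^ 4"
          by (simp only: octa_vertex_def fps_of_poly_mult fps_of_poly_power fps_of_poly_fps_X)
        moreover have "geom_fps ^ (4 * n + 5) = geom_fps ^ 4 * geom_fps ^ (4 * n' + 5)"
          by (simp add: n flip: power_add)
        ultimately show ?thesis by (simp only: mult_ac)
      qed
      then show ?thesis by (simp only: fps_X_mult_nth n) simp
    qed
    also have "geom_fps ^ 4 * fps_of_poly [:1, -1:] ^ 4 = 1"
    proof -
      have "fps_of_poly [:1, -1:] = (1 - fps_X :: real fps)"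
        by (simp add: fps_of_poly_pCons)
      then show ?thesis
        by (simp only: geom_fps_mult power_one flip: power_mult_distrib)
    qed
    finally show ?thesis
      using less.IH[of "m - 3" q n'] q(2) less.prems(2) False n by simp
  qed
  with split octa_residue_face show ?case by simp
qed

lemma geom_fps_power_nth:
  assumes "r > 0"
  shows "fps_nth (geom_fps ^ r) i = of_nat ((r + i - 1) choose i)"
proof -
  have "geom_fps ^ r = inverse ((1 - fps_const 1 * fps_X) ^ r)"
    by (simp only: geom_fps_def fps_inverse_power fps_const_1_eq_1 mult_1)
  with one_minus_const_fps_X_neg_power'[OF assms, of "1::real"] show ?thesis by simp
qed

text \<open>The value of \<open>c\<close> makes the coefficient of \<open>z\<close> in \<open>F / (1 - z)\<^bsup>4 k + 9\<^esup>\<close> vanish.\<close>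

lemma extremal_relation:
  fixes k :: nat and g :: "real poly"
  defines "c \<equiv> 4 * real k + 32"
  defines "F \<equiv> octa_edge * octa_face * (octa_face ^ 3 - smult c octa_vertex)"
  assumes "type_II (3 * k + 1) g" and "coeff g 0 = 1"
    and "\<And>j. 1 \<le> j \<Longrightarrow> j \<le> k \<Longrightarrow> coeff g j = 0"
  shows "fps_nth (fps_of_poly F * geom_fps ^ (4 * k + 9)) (k + 2) = - coeff g (k + 2)"
proof -
  define H where "H = fps_of_poly F * geom_fps ^ (4 * k + 9)"
  have "fps_nth (fps_of_poly g * H) (k + 2) = 0"
  proof -
    have "fps_nth (fps_of_poly (g * octa_edge * octa_face ^ 4) * geom_fps ^ (4 * (k + 1) + 5)) (Suc (k + 1)) = 0"
      by (rule octa_residue[OF assms(3)]) simp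
    moreover have "fps_nth (fps_of_poly (g * octa_edge * octa_face ^ 1) * geom_fps ^ (4 * k + 5)) (Suc k) = 0"
      by (rule octa_residue[OF assms(3)]) simp
    moreover have "fps_of_poly g * H
      = fps_of_poly (g * octa_edge * octa_face ^ 4) * geom_fps ^ (4 * (k + 1) + 5)
        - fps_const c * (fps_X * (fps_of_poly (g * octa_edge * octa_face ^ 1) * geom_fps ^ (4 * k + 5)))"
    proof -
      have vertex: "fps_of_poly octa_vertex * geom_fps ^ (4 * k + 9) = fps_X * geom_fps ^ (4 * k + 5)"
      proof -
        have inv: "geom_fps ^ 4 * (1 - fps_X) ^ 4 = 1"
          by (simp add: geom_fps_mult flip: power_mult_distrib)
        have "geom_fps ^ (4 * k + 9) = geom_fps ^ 4 * geom_fps ^ (4 * k + 5)"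
          unfolding power_add[symmetric] by (rule arg_cong[where f = "(^) geom_fps"]) simp
        moreover have "fps_of_poly octa_vertex = fps_X * (1 - fps_X) ^ 4"
          by (simp add: octa_vertex_def fps_of_poly_mult fps_of_poly_power fps_of_poly_pCons)
        ultimately have "fps_of_poly octa_vertex * geom_fps ^ (4 * k + 9)
          = fps_X * geom_fps ^ (4 * k + 5) * (geom_fps ^ 4 * (1 - fps_X) ^ 4)"
          by (simp only: mult_ac)
        then show ?thesis by (simp only: inv mult_1_right)
      qed
      have "g * F = g * octa_edge * octa_face ^ 4 - smult c (octa_vertex * (g * octa_edge * octa_face ^ 1))"
        by (simp add: F_def algebra_simps eval_nat_numeral)
      moreover have "fps_of_poly g * H = fps_of_poly (g * F) * geom_fps ^ (4 * k + 9)"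
        by (simp only: H_def fps_of_poly_mult mult.assoc)
      ultimately have "fps_of_poly g * H
        = (fps_of_poly (g * octa_edge * octa_face ^ 4)
           - fps_const c * (fps_of_poly octa_vertex * fps_of_poly (g * octa_edge * octa_face ^ 1)))
          * geom_fps ^ (4 * k + 9)"
        by (simp only: fps_of_poly_diff fps_of_poly_smult fps_of_poly_mult[of octa_vertex])
      also have "\<dots> = fps_of_poly (g * octa_edge * octa_face ^ 4) * geom_fps ^ (4 * k + 9)
        - fps_const c * (fps_of_poly (g * octa_edge * octa_face ^ 1)
          * (fps_of_poly octa_vertex * geom_fps ^ (4 * k + 9)))"
        by (simp add: left_diff_distrib mult.assoc)
      also have "\<dots> = fps_of_poly (g * octa_edge * octa_face ^ 4) * geom_fps ^ (4 * (k + 1) + 5)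
        - fps_const c * (fps_X * (fps_of_poly (g * octa_edge * octa_face ^ 1) * geom_fps ^ (4 * k + 5)))"
      proof -
        have "4 * (k + 1) + 5 = 4 * k + 9" by simp
        then show ?thesis unfolding vertex by (simp only: mult_ac)
      qed
      finally show ?thesis .
    qed
    ultimately show ?thesis
      by (simp only: fps_sub_nth fps_mult_left_const_nth fps_X_mult_nth) simp
  qed
  moreover have "fps_nth (fps_of_poly g * H) (k + 2)
    = fps_nth H (k + 2) + coeff g (k + 1) * fps_nth H 1 + coeff g (k + 2) * fps_nth H 0"
  proof -
    have "(\<Sum>i = 0..k. coeff g i * fps_nth H (k + 2 - i)) = (\<Sum>i = 0..k. if i = 0 then fps_nth H (k + 2) else 0)"
      using assms(4,5) by (intro sum.cong) auto
    then show ?thesis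
      by (simp add: fps_mult_nth numeral_2_eq_2)
  qed
  \<comment> \<open>The coefficient of z in (1 - z)^(-(4 k + 9)) is 4 k + 9, and 23 - c + 4 k + 9 =
    0; this removes the unknown \<open>coeff g (k + 1)\<close>.\<close>
  moreover have "coeff F 0 = 1" "coeff F 1 = 23 - c"
    by (simp_all add: F_def octa_edge_def octa_face_def octa_vertex_def eval_nat_numeral)
  then have "fps_nth H 0 = 1" "fps_nth H 1 = 0"
    using geom_fps_power_nth[of "4 * k + 9"] by (simp_all add: H_def fps_mult_nth c_def)
  ultimately show ?thesis by (simp add: H_def)
qed

section \<open>Positivity of the coefficient in the extremal relation\<close>

primrec hyper_horner :: "(nat \<Rightarrow> 'b) \<Rightarrow> (nat \<Rightarrow> 'b) \<Rightarrow> (nat \<Rightarrow> 'b) \<Rightarrow> nat \<Rightarrow> 'b::comm_ring_1" where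
  "hyper_horner f n d 0 = f 0"
| "hyper_horner f n d (Suc N) = d N * hyper_horner f n d N + f (Suc N) * (\<Prod>j\<le>N. n j)"

text \<open>\<open>hyper_horner\<close> sums a sequence with term ratios \<open>n j / d j\<close>
  without division, by clearing the common denominator. The induction also carries the last term
  \<open>b N\<close>, which the next summand requires.\<close>

lemma hypergeometric_sum:
  fixes b d n f :: "nat \<Rightarrow> 'b::comm_ring_1"
  assumes "\<And>j. j < N \<Longrightarrow> d j * b (Suc j) = n j * b j"
  shows "(\<Prod>j<N. d j) * (\<Sum>i\<le>N. f i * b i) = b 0 * hyper_horner f n d N"
proof -
  have "(\<Prod>j<N. d j) * b N = b 0 * (\<Prod>j<N. n j)
    \<and> (\<Prod>j<N. d j) * (\<Sum>i\<le>N. f i * b i) = b 0 * hyper_horner f n d N"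
    using assms
  proof (induction N)
    case (Suc N)
    then have IH: "(\<Prod>j<N. d j) * b N = b 0 * (\<Prod>j<N. n j)"
      "(\<Prod>j<N. d j) * (\<Sum>i\<le>N. f i * b i) = b 0 * hyper_horner f n d N"
      by auto
    have "(\<Prod>j<Suc N. d j) * b (Suc N) = (\<Prod>j<N. d j) * (d N * b (Suc N))"
      by (simp add: mult_ac)
    also have "\<dots> = n N * ((\<Prod>j<N. d j) * b N)"
      using Suc.prems[of N] by (simp only: mult_ac lessI simp_thms)
    also have "\<dots> = b 0 * (\<Prod>j<Suc N. n j)"
      unfolding IH(1) by (simp add: mult_ac)
    finally have b: "(\<Prod>j<Suc N. d j) * b (Suc N) = b 0 * (\<Prod>j<Suc N. n j)" .
    have "(\<Prod>j<Suc N. d j) * (\<Sum>i\<le>Suc N. f i * b i)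
      = d N * ((\<Prod>j<N. d j) * (\<Sum>i\<le>N. f i * b i)) + f (Suc N) * ((\<Prod>j<Suc N. d j) * b (Suc N))"
      by (simp add: algebra_simps)
    also have "\<dots> = b 0 * hyper_horner f n d (Suc N)"
      unfolding IH(2) b by (simp add: lessThan_Suc_atMost algebra_simps)
    finally show ?case using b by blast
  qed simp
  then show ?thesis ..
qed

definition extremal_coeffs0 :: "real poly" where
  "extremal_coeffs0 = [:1, 23, -701, -29643, -365862, -1700970, -1700970, -365862, -29643, -701, 23, 1:]"

definition extremal_coeffs1 :: "real poly" where
  "extremal_coeffs1 = [:0, 1, -23, -412, 1364, -930, -930, 1364, -412, -23, 1:]"

lemma extremal_coeffs_eq:
  "octa_edge * octa_face * (octa_face ^ 3 - smult c octa_vertex)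
    = extremal_coeffs0 - smult c extremal_coeffs1"
  by (simp add: extremal_coeffs0_def extremal_coeffs1_def octa_edge_def octa_face_def
      octa_vertex_def eval_nat_numeral)

text \<open>Here \<open>k = m + 159\<close>, so that the three constants are \<open>4 k + 32\<close>, \<open>k + 2\<close> and \<open>5 k + 10\<close>.\<close>

lemma extremal_polynomial_pos:
  fixes m :: real
  assumes "m \<ge> 0"
  shows "hyper_horner (\<lambda>i. coeff extremal_coeffs0 i - (4 * m + 668) * coeff extremal_coeffs1 i)
    (\<lambda>j. m + 161 - real j) (\<lambda>j. 5 * m + 805 - real j) 11 > 0"
proof -
  have rec: "hyper_horner f n d (numeral w) = d (pred_numeral w) * hyper_horner f n d (pred_numeral w)
      + f (numeral w) * (\<Prod>j\<le>pred_numeral w. n j)"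
    and prod: "(\<Prod>j\<le>numeral w. n j) = (\<Prod>j\<le>pred_numeral w. n j) * n (numeral w)"
    and cf: "coeff (pCons a p) (numeral w) = coeff p (pred_numeral w)"
    and prod0: "(\<Prod>j\<le>0. n j) = n 0"
    and real1: "real (Suc 0) = 1"
    for f n d :: "nat \<Rightarrow> real" and a :: real and p w
    by (simp_all add: numeral_eq_Suc)
  have "hyper_horner (\<lambda>i. coeff extremal_coeffs0 i - (4 * m + 668) * coeff extremal_coeffs1 i)
    (\<lambda>j. m + 161 - real j) (\<lambda>j. 5 * m + 805 - real j) 11 =
      124503181218301236934736137420800 + 726146123121631453854103885578240 * m
      + 49782916929988794291577305133056 * m ^ 2 + 1558058898628541938970255010816 * m ^ 3
      + 29289233644515969226782405120 * m ^ 4 + 367221988331531182907827200 * m ^ 5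
      + 3223599791166316318975488 * m ^ 6 + 20215239676920365027328 * m ^ 7
      + 90556954333132339200 * m ^ 8 + 283978005964431360 * m ^ 9
      + 593706151673856 * m ^ 10 + 744767225856 * m ^ 11
      + 424673280 * m ^ 12"
    unfolding extremal_coeffs0_def extremal_coeffs1_def
    by (simp only: rec prod cf pred_numeral_simps Num.BitM.simps numeral_One One_nat_def
        hyper_horner.simps prod.atMost_Suc prod0 coeff_pCons_0 coeff_pCons_Suc coeff_0
        of_nat_0 real1 of_nat_numeral) algebra
  \<comment> \<open>Expanding around \<open>k = 159\<close> makes every coefficient positive. At
    \<open>m = - 1\<close> the polynomial is negative, which explains the bound 159.\<close>
  also have "\<dots> > 0"
    using assms by (simp add: add_pos_nonneg)
  finally show ?thesis .
qed

text \<open>The coefficient is a sum of twelve terms, as \<open>F\<close> has degree at most 11. The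
  binomials \<open>b j\<close> have ratios \<open>(k + 2 - j) / (5 k + 10 - j)\<close> by
  absorption, so \<open>hyper_horner\<close> determines its sign.\<close>

lemma extremal_fps_pos:
  fixes k :: nat
  assumes "k \<ge> 159"
  defines "F \<equiv> octa_edge * octa_face * (octa_face ^ 3 - smult (4 * real k + 32) octa_vertex)"
  shows "fps_nth (fps_of_poly F * geom_fps ^ (4 * k + 9)) (k + 2) > 0"
proof -
  define m where "m = real k - 159"
  define b where "b j = real ((5 * k + 10 - j) choose (k + 2 - j))" for j
  let ?f = "\<lambda>i. coeff extremal_coeffs0 i - (4 * m + 668) * coeff extremal_coeffs1 i"
  let ?n = "\<lambda>j. m + 161 - real j" and ?d = "\<lambda>j. 5 * m + 805 - real j"
  have F: "coeff F i = ?f i" for i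
    by (simp add: F_def extremal_coeffs_eq m_def)
  have F0: "coeff F i = 0" if "i > 11" for i
  proof -
    have "degree extremal_coeffs0 = 11" "degree extremal_coeffs1 = 10"
      by (simp_all add: extremal_coeffs0_def extremal_coeffs1_def)
    with that show ?thesis by (simp add: F coeff_eq_0)
  qed
  have geom: "fps_nth (geom_fps ^ (4 * k + 9)) (k + 2 - i) = b i" if "i \<le> k + 2" for i
    using that geom_fps_power_nth[of "4 * k + 9" "k + 2 - i"] by (simp add: b_def add.commute)
  have "fps_nth (fps_of_poly F * geom_fps ^ (4 * k + 9)) (k + 2) = (\<Sum>i = 0..k + 2. coeff F i * b i)"
    unfolding fps_mult_nth by (intro sum.cong refl) (simp only: geom fps_of_poly_nth atLeastAtMost_iff)
  also have "\<dots> = (\<Sum>i\<le>11. ?f i * b i)"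
    using assms(1) F0 by (intro sum.mono_neutral_cong_right) (auto simp: F)
  finally have eq: "fps_nth (fps_of_poly F * geom_fps ^ (4 * k + 9)) (k + 2) = (\<Sum>i\<le>11. ?f i * b i)" .
  have "?d j * b (Suc j) = ?n j * b j" if "j < 11" for j
  proof -
    have "(k + 2 - j) * ((5 * k + 10 - j) choose (k + 2 - j))
      = (5 * k + 10 - j) * ((5 * k + 10 - j - 1) choose (k + 2 - j - 1))"
      using that assms(1) by (intro times_binomial_minus1_eq) simp
    then have "real (k + 2 - j) * b j = real (5 * k + 10 - j) * b (Suc j)"
      unfolding b_def by (simp flip: of_nat_mult)
    then show ?thesis
      using that assms(1) by (simp add: of_nat_diff m_def)
  qed
  then have "(\<Prod>j<11. ?d j) * (\<Sum>i\<le>11. ?f i * b i) = b 0 * hyper_horner ?f ?n ?d 11"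
    by (rule hypergeometric_sum)
  also have "\<dots> > 0"
    using assms(1) by (intro mult_pos_pos extremal_polynomial_pos) (auto simp: b_def m_def)
  finally have "0 < (\<Prod>j<11. ?d j) * (\<Sum>i\<le>11. ?f i * b i)" .
  moreover have "(\<Prod>j<11. ?d j) > 0"
    using assms(1) by (intro prod_pos) (auto simp: m_def)
  ultimately show ?thesis
    unfolding eq by (simp add: zero_less_mult_iff)
qed

text \<open>Self-duality gives \<open>card D = 16 ^ m\<close>, which normalises the MacWilliams
  identity; the reciprocal symmetry is complementation, as the all-ones word lies in
  \<open>D\<close>.\<close>

lemma weight_enumerator_type_II:
  fixes D :: "'a::finite set set"
  assumes D: "binary_code D" "doubly_even D" "binary_dual D = D" and card: "CARD('a) = 8 * m"
  shows "type_II m (\<Sum>A\<in>D. monom 1 (card A div 4))"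
proof -
  let ?g = "\<Sum>A\<in>D. monom (1::real) (card A div 4)"
  have weight: "4 * (card A div 4) = card A" if "A \<in> D" for A
    using D(2) that by (auto simp: doubly_even_def)
  have le: "card A \<le> 8 * m" for A :: "'a set"
    unfolding card[symmetric] by (simp add: card_mono)
  have g: "poly ?g (y ^ 4) = (\<Sum>A\<in>D. y ^ card A)" for y
    by (simp add: poly_sum poly_monom weight flip: power_mult)
  have "degree ?g \<le> 2 * m"
  proof (rule degree_sum_le)
    fix A assume "A \<in> D"
    have "card A div 4 \<le> 2 * m" using le[of A] by simp
    then show "degree (monom (1::real) (card A div 4)) \<le> 2 * m"
      by (simp add: degree_monom_eq)
  qed simp
  moreover have "16 ^ m * poly ?g (y ^ 4) = (1 + y) ^ (8 * m) * poly ?g (((1 - y) / (1 + y)) ^ 4)"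
    if "0 < y" "y < 1" for y :: real
  proof -
    have "(card D)\<^sup>2 = (16 ^ m)\<^sup>2"
      using card_binary_dual[OF D(1)] D(3) card by (simp add: power2_eq_square power_mult flip: power_mult_distrib)
    then have "card D = 16 ^ m" by (simp only: power2_eq_iff_nonneg zero_le)
    then have "16 ^ m * poly ?g (y ^ 4) = real (card D) * (\<Sum>A\<in>D. y ^ card A)"
      by (simp add: g)
    also have "\<dots> = (\<Sum>A\<in>D. (1 + y) ^ (8 * m - card A) * (1 - y) ^ card A)"
      using MacWilliams_identity[OF D(1), of y] D(3) card by simp
    also have "\<dots> = (\<Sum>A\<in>D. (1 + y) ^ (8 * m) * ((1 - y) / (1 + y)) ^ card A)"
      using that le by (intro sum.cong) (simp_all add: power_diff power_divide)
    finally show ?thesis by (simp add: g sum_distrib_left)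
  qed
  moreover have "poly ?g z = z ^ (2 * m) * poly ?g (1 / z)" if "0 < z" "z < 1" for z :: real
  proof -
    have "UNIV \<in> D"
      using D(2) by (subst D(3)[symmetric]) (auto simp: binary_dual_def doubly_even_def intro: dvd_trans[of 2 4])
    then have "bij_betw (\<lambda>A. sym_diff A UNIV) D D"
      by (intro bij_betw_sym_diff D(1))
    then have bij: "bij_betw uminus D D"
      by (simp add: Compl_eq_Diff_UNIV[symmetric])
    have "poly ?g z = (\<Sum>A\<in>D. z ^ (card A div 4))"
      by (simp add: poly_sum poly_monom)
    also have "\<dots> = (\<Sum>A\<in>D. z ^ (card (- A) div 4))"
      by (rule sum.reindex_bij_betw[OF bij, symmetric])
    also have "\<dots> = (\<Sum>A\<in>D. z ^ (2 * m) * (1 / z) ^ (card A div 4))"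
    proof (rule sum.cong)
      fix A assume "A \<in> D"
      have "card (- A) = 8 * m - card A"
        by (simp add: Compl_eq_Diff_UNIV card_Diff_subset card)
      then have "card (- A) div 4 = 2 * m - card A div 4" "card A div 4 \<le> 2 * m"
        using weight[OF \<open>A \<in> D\<close>] le[of A] by linarith+
      then show "z ^ (card (- A) div 4) = z ^ (2 * m) * (1 / z) ^ (card A div 4)"
        using that by (simp add: power_diff power_divide)
    qed simp
    finally show ?thesis
      by (simp add: poly_sum poly_monom sum_distrib_left)
  qed
  ultimately show ?thesis unfolding type_II_def by blast
qed

text \<open>Otherwise \<open>extremal_relation\<close> and \<open>extremal_fps_pos\<close> make
  \<open>coeff g (k + 2)\<close> negative, although it counts words of weight
  \<open>4 * k + 8\<close>.\<close>

theorem no_extremal_doubly_even: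
  fixes D :: "'a::finite set set"
  assumes D: "binary_code D" "doubly_even D" "binary_dual D = D"
    and card: "CARD('a) = 24 * k + 8" and k: "k \<ge> 159"
  obtains A where "A \<in> D" "A \<noteq> {}" "card A \<le> 4 * k"
proof (rule ccontr)
  note * = that
  assume "\<not> thesis"
  then have big: "card A > 4 * k" if "A \<in> D" "A \<noteq> {}" for A
    using *[OF that] by (meson not_le)
  define g where "g = (\<Sum>A\<in>D. monom (1::real) (card A div 4))"
  have coeff: "coeff g j = real (card {A \<in> D. card A div 4 = j})" for j
    by (simp add: g_def coeff_sum sum.If_cases Int_def)
  have "{} \<in> D" using D(1) by (simp add: binary_code_def)
  have div4: "card A div 4 > k" if "A \<in> D" "A \<noteq> {}" for A
  proof -
    have "4 dvd card A" using D(2) that by (auto simp: doubly_even_def)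
    with big[OF that] show ?thesis by auto
  qed
  have "type_II (3 * k + 1) g"
    unfolding g_def by (rule weight_enumerator_type_II[OF D]) (simp add: card)
  moreover have "{A \<in> D. card A div 4 = 0} = {{}}"
  proof (intro set_eqI iffI)
    fix A assume "A \<in> {A \<in> D. card A div 4 = 0}"
    then show "A \<in> {{}}" using div4[of A] by (cases "A = {}") auto
  qed (use \<open>{} \<in> D\<close> in auto)
  then have "coeff g 0 = 1" by (simp only: coeff) simp
  moreover have "coeff g j = 0" if "1 \<le> j" "j \<le> k" for j
  proof -
    have "card A div 4 \<noteq> j" if "A \<in> D" for A
      using div4[of A] that \<open>1 \<le> j\<close> \<open>j \<le> k\<close> by (cases "A = {}") auto
    then have "{A \<in> D. card A div 4 = j} = {}" by blast
    then show ?thesis by (simp only: coeff) simp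
  qed
  ultimately have "coeff g (k + 2) < 0"
    using extremal_relation[of k g] extremal_fps_pos[OF k] by simp
  then show False by (simp only: coeff)
qed

section \<open>Self-dual codes over the integers modulo 4\<close>

lemma Z4_cases: "x = 0 \<or> x = 1 \<or> x = 2 \<or> x = 3" for x :: Z4
  using exhaust_4[of x] by auto

lemma Z4_odd_add: "2 * (a + b) \<noteq> 0 \<longleftrightarrow> (2 * a \<noteq> 0) \<noteq> (2 * b \<noteq> 0)" for a b :: Z4
  using Z4_cases[of a] Z4_cases[of b] by auto

lemma Z4_square: "a * a = of_bool (2 * a \<noteq> 0)" for a :: Z4
  using Z4_cases[of a] by auto

lemma Z4_double: "2 * a = 2 * of_bool (2 * a \<noteq> 0)" for a :: Z4
  using Z4_cases[of a] by auto

lemma Z4_of_nat_eq_0: "(of_nat n :: Z4) = 0 \<longleftrightarrow> 4 dvd n"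
  by (simp add: of_nat_eq_0_iff_char_dvd)

lemma two_neq_0: "(2::Z4) \<noteq> 0"
  using Z4_of_nat_eq_0[of 2] by simp

text \<open>An element of \<open>Z4\<close> is odd exactly when its double is non-zero, so this is
  the support of the word reduced modulo 2.\<close>

definition odd_support :: "Z4 ^ 'n \<Rightarrow> 'n set" where
  "odd_support c = {j. 2 * c $ j \<noteq> 0}"

definition double_word :: "'n set \<Rightarrow> Z4 ^ 'n" where
  "double_word A = (\<chi> j. if j \<in> A then 2 else 0)"

lemma binary_code_odd_support:
  assumes "Z4_code C"
  shows "binary_code (odd_support ` C)"
proof -
  have sub: "0 \<in> C" "\<And>x y. x \<in> C \<Longrightarrow> y \<in> C \<Longrightarrow> x + y \<in> C"
    using assms by (simp_all add: Z4_code_def module.subspace_def[OF module_Z4_vec])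
  have add: "sym_diff (odd_support x) (odd_support y) = odd_support (x + y)" for x y :: "Z4 ^ 'n"
    unfolding odd_support_def vector_add_component Z4_odd_add by blast
  show ?thesis
    unfolding binary_code_def
  proof (intro conjI ballI)
    have "odd_support 0 = {}" by (simp add: odd_support_def)
    then show "{} \<in> odd_support ` C" using sub(1) by (metis imageI)
    fix A B assume "A \<in> odd_support ` C" "B \<in> odd_support ` C"
    then obtain x y where "x \<in> C" "A = odd_support x" "y \<in> C" "B = odd_support y"
      by (elim imageE)
    then show "sym_diff A B \<in> odd_support ` C"
      unfolding \<open>A = _\<close> \<open>B = _\<close> add by (intro imageI sub(2))
  qed
qed

text \<open>Squares in \<open>Z4\<close> are 1 for odd and 0 for even elements, so the inner product
  of a word with itself counts its odd entries modulo 4.\<close>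

lemma doubly_even_odd_support:
  assumes "self_dual C"
  shows "doubly_even (odd_support ` C)"
  unfolding doubly_even_def
proof clarify
  fix c assume "c \<in> C"
  then have "scalar_product c c = 0"
    using assms by (auto simp: self_dual_def dual_code_def)
  moreover have "scalar_product c c = of_nat (card (odd_support c))"
    by (simp add: scalar_product_def Z4_square odd_support_def sum.If_cases of_bool_def)
  ultimately show "4 dvd card (odd_support c)"
    by (simp add: Z4_of_nat_eq_0)
qed

text \<open>Doubling an element of \<open>Z4\<close> retains only its parity, so the inner product
  with \<open>c\<close> is twice the even size of \<open>odd_support c \<inter> A\<close>.\<close>

lemma double_word_in_self_dual:
  assumes "self_dual C" and "A \<in> binary_dual (odd_support ` C)"
  shows "double_word A \<in> C"
proof -
  have "scalar_product (double_word A) c = 0" if "c \<in> C" for c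
  proof -
    have "scalar_product (double_word A) c = (\<Sum>j\<in>UNIV. if j \<in> odd_support c \<inter> A then 2 else 0)"
      unfolding scalar_product_def
    proof (rule sum.cong)
      fix j show "double_word A $ j * c $ j = (if j \<in> odd_support c \<inter> A then 2 else 0)"
        using Z4_double[of "c $ j"] by (auto simp: double_word_def odd_support_def)
    qed simp
    also have "\<dots> = of_nat (2 * card (odd_support c \<inter> A))"
      by (simp add: sum.If_cases Int_def)
    also have "\<dots> = 0"
      using assms(2) that by (subst Z4_of_nat_eq_0) (auto simp: binary_dual_def elim!: evenE)
    finally show ?thesis .
  qed
  then have "double_word A \<in> dual_code C" by (simp add: dual_code_def)
  with assms(1) show ?thesis by (simp add: self_dual_def)
qed

lemma Lee_weight_double_word: "Lee_weight (double_word A) = 2 * card A"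
proof -
  have neq: "(2::Z4) \<noteq> 1" "(2::Z4) \<noteq> 3" "(0::Z4) \<noteq> 1" "(0::Z4) \<noteq> 2" "(0::Z4) \<noteq> 3"
    by simp_all
  have "{j. double_word A $ j = 1} = {}" "{j. double_word A $ j = 2} = A" "{j. double_word A $ j = 3} = {}"
    using neq by (auto simp: double_word_def)
  then show ?thesis
    by (simp add: Lee_weight_def num_components_def)
qed

theorem corollary3p8:
  fixes k :: nat and C :: "(Z4 ^ 'n) set"
  assumes "k \<ge> 159"
    and "CARD('n) = 24 * k + 8"
    and "Z4_code C"
    and "self_dual C"
  shows "min_Lee_weight C \<le> 8 * k + 4"
proof -
  have "8 dvd CARD('n)" unfolding assms(2) by presburger
  then obtain D where D: "odd_support ` C \<subseteq> D" "binary_code D" "doubly_even D" "binary_dual D = D"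
    using doubly_even_self_dual_extension[OF binary_code_odd_support[OF assms(3)]
        doubly_even_odd_support[OF assms(4)]] by blast
  obtain A where A: "A \<in> D" "A \<noteq> {}" "card A \<le> 4 * k"
    using no_extremal_doubly_even[OF D(2-4) assms(2,1)] .
  have "A \<in> binary_dual D" using A(1) D(4) by simp
  \<comment> \<open>Duality reverses inclusions, so the self-dual \<open>D\<close> lies in the dual
    of the smaller code.\<close>
  then have "A \<in> binary_dual (odd_support ` C)"
    using D(1) by (auto simp: binary_dual_def)
  then have "double_word A \<in> C" by (rule double_word_in_self_dual[OF assms(4)])
  moreover have "double_word A \<noteq> 0"
    using A(2) by (auto simp: double_word_def vec_eq_iff two_neq_0)
  ultimately have "min_Lee_weight C \<le> Lee_weight (double_word A)"
    unfolding min_Lee_weight_def by (intro Min_le) auto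
  with A(3) show ?thesis by (simp add: Lee_weight_double_word)
qed

end
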